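(* Let $n\ge 1$, let $x_{1,n-1}<\cdots<x_{n-1,n-1}$ be the zeros of $p_{n-1}$ and $x_{1,n}<\cdots<x_{n,n}$ the zeros of $p_n$, where $(p_m)_{m\ge 0}$ are the orthonormal polynomials of $\mu$ with recurrence coefficients $(a_{m+1},b_m)_{m\ge 0}$. Then $$\begin{pmatrix} x_{1,n-1}\\ x_{2,n-1}\\ \vdots\\ x_{n-1,n-1}\\ b_{n-1}\end{pmatrix} = A\begin{pmatrix} x_{1,n}\\ x_{2,n}\\ \vdots\\ x_{n-1,n}\\ x_{n,n}\end{pmatrix},$$ where $A=(a_{i,j})_{i,j=1}^n$ is a doubly stochastic matrix with entries, for $1\le j\le n$, $$a_{i,j}=\begin{cases}\displaystyle \frac{a_n^2\,\lambda_{j,n}\,p_{n-1}^2(x_{j,n})\,\lambda_{i,n-1}\,p_n^2(x_{i,n-1})}{(x_{j,n}-x_{i,n-1})^2}, & 1\le i\le n-1,\\[10pt] \lambda_{j,n}\,p_{n-1}^2(x_{j,n}), & i=n.\end{cases}$$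
   Context: $\mu$ is a probability measure on $\mathbb{R}$ with infinite support and all moments finite. The orthonormal polynomials $p_m(x)=\gamma_m x^m+\cdots$, $\gamma_m>0$, satisfy $\int p_m p_l\,d\mu=\delta_{m,l}$ and the three-term recurrence $x p_m(x)=a_{m+1}p_{m+1}(x)+b_m p_m(x)+a_m p_{m-1}(x)$ for $m\ge 0$ (with $p_{-1}=0$), where $a_m=\int x p_m p_{m-1}\,d\mu=\gamma_{m-1}/\gamma_m>0$ for $m\ge1$ and $b_m=\int x p_m^2\,d\mu\in\mathbb{R}$ for $m\ge 0$. The polynomial $p_m$ has $m$ real simple zeros, denoted in increasing order $x_{1,m}<\cdots<x_{m,m}$; the zeros of $p_{n-1}$ and $p_n$ strictly interlace. The Christoffel numbers are $\lambda_{j,m}=1/\sum_{l=0}^{m-1}p_l^2(x_{j,m})$ for $1\le j\le m$. A square matrix is doubly stochastic if its entries are nonnegative and every row and every column sums to $1$. (The matrix entries $a_{i,j}$, with two indices, are not to be confused with the recurrence coefficients $a_m$.) *)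

theory Defs
  imports
    "HOL-Probability.Probability"
    "HOL-Computational_Algebra.Polynomial"
    "Jordan_Normal_Form.Matrix"
begin

definition measure_support :: "'a::topological_space measure \<Rightarrow> 'a set" where
  "measure_support M = {x. \<forall>U. open U \<and> x \<in> U \<longrightarrow> emeasure M U > 0}"

(* The conditions determine the family p uniquely. *)
definition orthonormal_polys :: "real measure \<Rightarrow> (nat \<Rightarrow> real poly) \<Rightarrow> bool" where
  "orthonormal_polys M p \<longleftrightarrow>
     (\<forall>m. degree (p m) = m \<and> lead_coeff (p m) > 0) \<and>
     (\<forall>m l. (\<integral>x. poly (p m) x * poly (p l) x \<partial>M) = (if m = l then 1 else 0))"

(* The coefficients a_m and b_m of the three-term recurrence
   x p_m(x) = a_(m+1) p_(m+1)(x) + b_m p_m(x) + a_m p_(m-1)(x);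
   rec_a is meaningful for m \<ge> 1 only. *)
definition rec_a :: "real measure \<Rightarrow> (nat \<Rightarrow> real poly) \<Rightarrow> nat \<Rightarrow> real" where
  "rec_a M p m = (\<integral>x. x * poly (p m) x * poly (p (m - 1)) x \<partial>M)"

definition rec_b :: "real measure \<Rightarrow> (nat \<Rightarrow> real poly) \<Rightarrow> nat \<Rightarrow> real" where
  "rec_b M p m = (\<integral>x. x * (poly (p m) x)\<^sup>2 \<partial>M)"

(* The j-th smallest real zero of p m, for 1 \<le> j \<le> m. *)
definition poly_zero :: "(nat \<Rightarrow> real poly) \<Rightarrow> nat \<Rightarrow> nat \<Rightarrow> real" where
  "poly_zero p j m = sorted_list_of_set {x. poly (p m) x = 0} ! (j - 1)"

definition christoffel :: "(nat \<Rightarrow> real poly) \<Rightarrow> nat \<Rightarrow> nat \<Rightarrow> real" where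
  "christoffel p j m = 1 / (\<Sum>l<m. (poly (p l) (poly_zero p j m))\<^sup>2)"

definition doubly_stochastic :: "real mat \<Rightarrow> bool" where
  "doubly_stochastic A \<longleftrightarrow>
     square_mat A \<and>
     (\<forall>i<dim_row A. \<forall>j<dim_col A. A $$ (i, j) \<ge> 0) \<and>
     (\<forall>i<dim_row A. (\<Sum>j<dim_col A. A $$ (i, j)) = 1) \<and>
     (\<forall>j<dim_col A. (\<Sum>i<dim_row A. A $$ (i, j)) = 1)"

(* Indices 1 \<le> i, j \<le> n as on paper; the type mat counts from 0, hence the shift
   in zeros_mat. *)
definition zeros_mat_entry ::
    "real measure \<Rightarrow> (nat \<Rightarrow> real poly) \<Rightarrow> nat \<Rightarrow> nat \<Rightarrow> nat \<Rightarrow> real" where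
  "zeros_mat_entry M p n i j =
     (if i \<le> n - 1 then
        (rec_a M p n)\<^sup>2
          * christoffel p j n * (poly (p (n - 1)) (poly_zero p j n))\<^sup>2
          * christoffel p i (n - 1) * (poly (p n) (poly_zero p i (n - 1)))\<^sup>2
          / (poly_zero p j n - poly_zero p i (n - 1))\<^sup>2
      else christoffel p j n * (poly (p (n - 1)) (poly_zero p j n))\<^sup>2)"

definition zeros_mat :: "real measure \<Rightarrow> (nat \<Rightarrow> real poly) \<Rightarrow> nat \<Rightarrow> real mat" where
  "zeros_mat M p n = mat n n (\<lambda>(i, j). zeros_mat_entry M p n (i + 1) (j + 1))"

end

theory Submission
  imports Defs "HOL-Computational_Algebra.Fundamental_Theorem_Algebra"
begin

text \<open>Write \<open>L f\<close> for the integral of a polynomial \<open>f\<close>, and \<open>q\<^sub>y = p\<^sub>n\<^sub>-\<^sub>1 / (X - y)\<close> for a zero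
  \<open>y\<close> of \<open>p\<^sub>n\<^sub>-\<^sub>1\<close>. The row of \<open>A\<close> belonging to \<open>y\<close> consists of a constant times
  \<open>\<lambda>\<^sub>x q\<^sub>y(x)\<^sup>2\<close> at the zeros \<open>x\<close> of \<open>p\<^sub>n\<close>. Gauss quadrature at these zeros turns the row sum and
  the row mean into \<open>L (q\<^sub>y\<^sup>2)\<close> and \<open>L (X q\<^sub>y\<^sup>2)\<close>, and quadrature at the zeros of \<open>p\<^sub>n\<^sub>-\<^sub>1\<close>, where
  \<open>q\<^sub>y\<close> vanishes except at \<open>y\<close>, evaluates these; their ratio is \<open>y\<close>. The column sums come from
  the polynomials \<open>q\<^sub>y\<close> and \<open>p\<^sub>n\<^sub>-\<^sub>1\<close> being an orthogonal basis, hence giving the same reproducing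
  kernel as \<open>p\<^sub>0, \<dots>, p\<^sub>n\<^sub>-\<^sub>1\<close>.\<close>

hide_const (open) Module.smult

section \<open>Real polynomials with only simple real roots\<close>

lemma poly_of_real_mult:
  fixes f g :: "real poly"
  shows "poly (map_poly complex_of_real (f * g)) z =
    poly (map_poly complex_of_real f) z * poly (map_poly complex_of_real g) z"
proof -
  have "map_poly complex_of_real (f * g) = map_poly complex_of_real f * map_poly complex_of_real g"
    by (rule poly_eqI) (simp add: coeff_map_poly coeff_mult)
  then show ?thesis by simp
qed

lemma poly_of_real_add:
  fixes f g :: "real poly"
  shows "poly (map_poly complex_of_real (f + g)) z =
    poly (map_poly complex_of_real f) z + poly (map_poly complex_of_real g) z"
proof -
  have "map_poly complex_of_real (f + g) = map_poly complex_of_real f + map_poly complex_of_real g"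
    by (rule poly_eqI) (simp add: coeff_map_poly)
  then show ?thesis by simp
qed

lemma poly_map_of_real: "poly (map_poly complex_of_real f) (of_real x) = of_real (poly f x)"
  by (induction f) (simp_all add: map_poly_pCons)

text \<open>The quadratic is \<open>(X - z)(X - cnj z)\<close>. The remainder of \<open>f\<close>
  modulo it is real, at most linear and vanishes at the nonreal \<open>z\<close>, which forces it to
  be zero.\<close>

lemma quadratic_dvd_of_nonreal_root:
  fixes f :: "real poly"
  assumes root: "poly (map_poly complex_of_real f) z = 0" and "Im z \<noteq> 0"
  shows "[:(Re z)\<^sup>2 + (Im z)\<^sup>2, - 2 * Re z, 1:] dvd f"
proof -
  define w where "w = [:(Re z)\<^sup>2 + (Im z)\<^sup>2, - 2 * Re z, 1:]"
  have w0: "poly (map_poly complex_of_real w) z = 0"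
    by (auto simp: w_def map_poly_pCons complex_eq_iff power2_eq_square algebra_simps)
  define r where "r = f mod w"
  have "f = w * (f div w) + r" by (simp add: r_def)
  then have r0: "poly (map_poly complex_of_real r) z = 0"
    using root w0 by (metis add_0 mult_zero_left poly_of_real_add poly_of_real_mult)
  have "w \<noteq> 0" "degree w = 2" by (auto simp: w_def)
  then have "degree r < 2" unfolding r_def
    using degree_mod_less[of w f] by auto
  define c0 c1 where "c0 = coeff r 0" and "c1 = coeff r 1"
  have r: "r = [:c0, c1:]"
  proof (rule poly_eqI)
    fix i show "coeff r i = coeff [:c0, c1:] i"
      using \<open>degree r < 2\<close> by (cases i; cases "i - 1") (auto simp: c0_def c1_def coeff_eq_0)
  qed
  with r0 have "Im z * c1 = 0" "c0 + Re z * c1 = 0"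
    by (auto simp: map_poly_pCons complex_eq_iff)
  with \<open>Im z \<noteq> 0\<close> r have "r = 0" by simp
  then show ?thesis unfolding r_def w_def by (simp add: mod_eq_0_iff_dvd)
qed

lemma prod_roots_dvd:
  fixes f :: "'a::idom poly"
  assumes "finite S" "\<And>x. x \<in> S \<Longrightarrow> poly f x = 0"
  shows "(\<Prod>x\<in>S. [:- x, 1:]) dvd f"
  using assms
proof (induction S arbitrary: f rule: finite_induct)
  case (insert a S)
  then obtain g where g: "f = [:- a, 1:] * g"
    by (metis insertI1 poly_eq_0_iff_dvd dvd_def)
  have "poly g x = 0" if "x \<in> S" for x
    using insert.prems[of x] insert.hyps that g by auto
  with insert.IH have "(\<Prod>x\<in>S. [:- x, 1:]) dvd g" by blast
  then show ?case
    unfolding g using insert.hyps by (simp add: mult_dvd_mono del: mult_pCons_left)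
qed auto

text \<open>Once the distinct real roots are divided out, any complex root of the cofactor yields a
  forbidden quadratic: \<open>b = 0\<close> for a repeated real root, a conjugate pair
  otherwise.\<close>

lemma card_real_roots:
  fixes f :: "real poly"
  assumes "f \<noteq> 0"
    and sq: "\<And>a b. \<not> [:a\<^sup>2 + b\<^sup>2, - 2 * a, 1:] dvd f"
  shows "card {x. poly f x = 0} = degree f"
proof -
  define S where "S = {x. poly f x = 0}"
  have "finite S" unfolding S_def using assms(1) by (rule poly_roots_finite)
  then have "(\<Prod>x\<in>S. [:- x, 1:]) dvd f"
    by (rule prod_roots_dvd) (simp add: S_def)
  then obtain g where g: "f = (\<Prod>x\<in>S. [:- x, 1:]) * g" by (auto elim: dvdE)
  with assms(1) have "g \<noteq> 0" by auto
  have "degree g = 0"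
  proof (rule ccontr)
    assume "degree g \<noteq> 0"
    then have "degree (map_poly complex_of_real g) \<noteq> 0"
      by (simp add: degree_map_poly)
    then have "\<not> constant (poly (map_poly complex_of_real g))"
      by (simp add: constant_degree)
    then obtain z where z: "poly (map_poly complex_of_real g) z = 0"
      using fundamental_theorem_of_algebra by blast
    show False
    proof (cases "Im z = 0")
      case True
      then have z_eq: "z = of_real (Re z)" by (simp add: complex_eq_iff)
      with z have "poly g (Re z) = 0"
        by (metis of_real_eq_0_iff poly_map_of_real)
      then have 1: "[:- Re z, 1:] dvd g" by (simp add: poly_eq_0_iff_dvd)
      have "poly f (Re z) = 0"
        using \<open>poly g (Re z) = 0\<close> by (subst g) simp
      then have "Re z \<in> S" by (simp add: S_def)
      then have 2: "[:- Re z, 1:] dvd (\<Prod>x\<in>S. [:- x, 1:])"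
        using \<open>finite S\<close> by (metis dvd_prodI)
      from mult_dvd_mono[OF 2 1] have "[:(Re z)\<^sup>2 + 0\<^sup>2, - 2 * Re z, 1:] dvd f"
        by (simp add: g power2_eq_square)
      with sq show False by blast
    next
      case False
      from quadratic_dvd_of_nonreal_root[OF z this] sq g show False
        by (metis dvd_mult)
    qed
  qed
  moreover have "degree (\<Prod>x\<in>S. [:- x, 1:]) = card S"
    by (subst degree_prod_sum_eq) auto
  ultimately have "degree f = card S"
    using g \<open>g \<noteq> 0\<close> assms(1) by (metis add_0_right degree_mult_eq mult_zero_left)
  then show ?thesis by (simp add: S_def)
qed

section \<open>Orthonormal polynomials of an abstract linear functional\<close>

text \<open>Linearity and orthonormality are all that the algebra takes from the integral;
  positivity on squares is derived from them.\<close>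

locale orthonormal_functional =
  fixes L :: "real poly \<Rightarrow> real" and p :: "nat \<Rightarrow> real poly"
  assumes L_add: "L (f + g) = L f + L g"
    and L_smult: "L (smult c f) = c * L f"
    and degree_p: "degree (p m) = m"
    and lead_coeff_p: "lead_coeff (p m) > 0"
    and ortho: "L (p m * p l) = (if m = l then 1 else 0)"
begin

lemma L_0 [simp]: "L 0 = 0"
  using L_smult[of 0 0] by simp

lemma L_diff: "L (f - g) = L f - L g"
  using L_add[of "f - g" g] by simp

lemma L_sum: "L (\<Sum>i\<in>I. f i) = (\<Sum>i\<in>I. L (f i))"
  by (induction I rule: infinite_finite_induct) (auto simp: L_add)

lemma p_nonzero [simp]: "p m \<noteq> 0"
  using lead_coeff_p[of m] by auto

text \<open>The hypothesis on coefficients, unlike \<open>degree f < m\<close>, can hold for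
  \<open>m = 0\<close>, where it says \<open>f = 0\<close>; this starts the induction.\<close>

lemma ex_expansion:
  assumes "\<And>i. i \<ge> m \<Longrightarrow> coeff f i = 0"
  shows "\<exists>c. f = (\<Sum>k<m. smult (c k) (p k))"
  using assms
proof (induction m arbitrary: f)
  case 0
  then show ?case by (simp add: poly_eq_iff)
next
  case (Suc m)
  define d where "d = coeff f m / lead_coeff (p m)"
  have "coeff (f - smult d (p m)) i = 0" if "i \<ge> m" for i
  proof (cases "i = m")
    case True
    then show ?thesis using lead_coeff_p[of m] by (simp add: d_def degree_p)
  next
    case False
    with that Suc.prems[of i] show ?thesis by (simp add: coeff_eq_0 degree_p)
  qed
  from Suc.IH[OF this] obtain c where c: "f - smult d (p m) = (\<Sum>k<m. smult (c k) (p k))"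
    by blast
  have "f = (\<Sum>k<m. smult (c k) (p k)) + smult d (p m)"
    using c by (simp add: algebra_simps)
  also have "\<dots> = (\<Sum>k<Suc m. smult ((c(m := d)) k) (p k))" by simp
  finally show ?case by blast
qed

lemma expansion:
  assumes "degree f < m"
  shows "f = (\<Sum>k<m. smult (L (f * p k)) (p k))"
proof -
  obtain c where c: "f = (\<Sum>k<m. smult (c k) (p k))"
    using ex_expansion[of m f] assms by (auto simp: coeff_eq_0)
  have "L (f * p k) = c k" if "k < m" for k
    unfolding c using that
    by (simp add: sum_distrib_right L_sum L_smult ortho if_distrib sum.delta cong: if_cong)
  then show ?thesis using c by simp
qed

lemma parseval:
  assumes "degree f < m"
  shows "L (f * g) = (\<Sum>k<m. L (f * p k) * L (g * p k))"
proof -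
  have "L (f * g) = L ((\<Sum>k<m. smult (L (f * p k)) (p k)) * g)"
    using expansion[OF assms] by simp
  also have "\<dots> = (\<Sum>k<m. L (f * p k) * L (g * p k))"
    by (simp add: sum_distrib_right L_sum L_smult mult.commute[of g])
  finally show ?thesis .
qed

lemma L_mult_p_eq_0:
  assumes "degree f < m"
  shows "L (f * p m) = 0"
  using parseval[OF assms, of "p m"] by (simp add: ortho)

text \<open>By Parseval this is a sum of squared Fourier coefficients, which determine
  \<open>f\<close> and so cannot all vanish.\<close>

lemma L_square_pos:
  assumes "f \<noteq> 0"
  shows "L (f * f) > 0"
proof -
  define m where "m = Suc (degree f)"
  have sq: "L (f * f) = (\<Sum>k<m. (L (f * p k))\<^sup>2)"
    using parseval[of f m f] by (simp add: m_def power2_eq_square)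
  moreover have "\<exists>k<m. L (f * p k) \<noteq> 0"
  proof (rule ccontr)
    assume "\<not> ?thesis"
    then have "(\<Sum>k<m. smult (L (f * p k)) (p k)) = 0" by simp
    with expansion[of f m] assms show False by (simp add: m_def)
  qed
  ultimately show ?thesis
    by (metis (mono_tags, lifting) finite_lessThan lessThan_iff sum_pos2 zero_le_power2 zero_less_power2)
qed

section \<open>Zeros of the orthonormal polynomials\<close>

definition Z :: "nat \<Rightarrow> real set" where
  "Z m = {x. poly (p m) x = 0}"

lemma finite_Z [simp]: "finite (Z m)"
  unfolding Z_def by (rule poly_roots_finite) simp

lemma Z_pos: "x \<in> Z m \<Longrightarrow> m > 0"
  using degree_p[of 0] p_nonzero[of 0] by (cases m) (auto simp: Z_def elim!: degree_eq_zeroE)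

text \<open>A factor \<open>(x - a)\<^sup>2 + b\<^sup>2\<close> (with \<open>b = 0\<close> for a repeated real zero) of \<open>p m\<close> would have a cofactor \<open>g\<close> of degree below \<open>m\<close>
  with \<open>L (p m * g) > 0\<close>.\<close>

lemma card_Z: "card (Z m) = m"
proof -
  have "\<not> [:a\<^sup>2 + b\<^sup>2, - 2 * a, 1:] dvd p m" for a b
  proof
    assume "[:a\<^sup>2 + b\<^sup>2, - 2 * a, 1:] dvd p m"
    then obtain g where g: "p m = [:a\<^sup>2 + b\<^sup>2, - 2 * a, 1:] * g" by (rule dvdE)
    then have "g \<noteq> 0" using p_nonzero[of m] by auto
    then have "degree (p m) = 2 + degree g"
      unfolding g by (subst degree_mult_eq) auto
    then have "L (g * p m) = 0"
      by (intro L_mult_p_eq_0) (simp add: degree_p)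
    \<comment> \<open>The quadratic equals \<open>(X - a)^2 + b^2\<close>, so \<open>g * p m\<close>
      is a sum of two squares of real polynomials, the first of them nonzero.\<close>
    moreover have "g * p m = ([:- a, 1:] * g) * ([:- a, 1:] * g) + smult (b\<^sup>2) (g * g)"
      unfolding g by (rule poly_eq_poly_eq_iff[THEN iffD1], rule ext)
        (simp add: algebra_simps power2_eq_square)
    moreover have "L (([:- a, 1:] * g) * ([:- a, 1:] * g)) > 0"
      using \<open>g \<noteq> 0\<close> by (intro L_square_pos) (metis mult_eq_0_iff one_neq_zero pCons_eq_0_iff)
    moreover have "L (smult (b\<^sup>2) (g * g)) \<ge> 0"
      using L_square_pos[OF \<open>g \<noteq> 0\<close>] by (simp add: L_smult)
    ultimately show False by (simp add: L_add)
  qed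
  from card_real_roots[OF p_nonzero this] show ?thesis by (simp add: Z_def degree_p)
qed

section \<open>Reproducing kernel and Christoffel numbers\<close>

text \<open>The Christoffel-Darboux kernel with one argument fixed at \<open>x\<close>, kept as a
  polynomial in the other so that \<open>L\<close> applies to it.\<close>

definition kernel :: "nat \<Rightarrow> real \<Rightarrow> real poly" where
  "kernel m x = (\<Sum>l<m. smult (poly (p l) x) (p l))"

definition lam :: "nat \<Rightarrow> real \<Rightarrow> real" where
  "lam m x = 1 / (\<Sum>l<m. (poly (p l) x)\<^sup>2)"

lemma poly_kernel_diag: "poly (kernel m x) x = (\<Sum>l<m. (poly (p l) x)\<^sup>2)"
  by (simp add: kernel_def poly_sum power2_eq_square)

lemma degree_kernel_less: "m > 0 \<Longrightarrow> degree (kernel m x) < m"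
  unfolding kernel_def
  by (rule degree_sum_less) (use degree_p degree_smult_le in \<open>auto intro: le_less_trans\<close>)

lemma kernel_reproducing:
  assumes "degree f < m"
  shows "L (kernel m x * f) = poly f x"
proof -
  have "L (kernel m x * f) = (\<Sum>k<m. L (f * p k) * poly (p k) x)"
    by (simp add: kernel_def sum_distrib_right L_sum L_smult mult.commute[of f]
        mult.commute[of "L u" for u])
  also have "\<dots> = poly (\<Sum>k<m. smult (L (f * p k)) (p k)) x"
    by (simp add: poly_sum)
  also have "\<dots> = poly f x" using expansion[OF assms] by simp
  finally show ?thesis .
qed

lemma poly_kernel_diag_pos:
  assumes "m > 0"
  shows "poly (kernel m x) x > 0"
proof -
  have "poly (p 0) x \<noteq> 0"
    using Z_pos[of x 0] by (auto simp: Z_def)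
  with assms show ?thesis unfolding poly_kernel_diag
    by (intro sum_pos2[of _ 0]) auto
qed

lemma lam_nonneg: "lam m x \<ge> 0"
  by (simp add: lam_def sum_nonneg)

section \<open>Cofactors of the linear factors\<close>

definition q :: "nat \<Rightarrow> real \<Rightarrow> real poly" where
  "q m x = p m div [:- x, 1:]"

lemma p_eq_q:
  assumes "x \<in> Z m"
  shows "p m = [:- x, 1:] * q m x"
  using assms by (simp add: Z_def q_def poly_eq_0_iff_dvd del: mult_pCons_left)

lemma poly_p_eq_q:
  assumes "x \<in> Z m"
  shows "poly (p m) t = (t - x) * poly (q m x) t"
  by (subst p_eq_q[OF assms]) (simp add: algebra_simps)

lemma q_nonzero: "x \<in> Z m \<Longrightarrow> q m x \<noteq> 0"
  using p_eq_q[of x m] p_nonzero[of m] by auto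

lemma degree_q:
  assumes "x \<in> Z m"
  shows "degree (q m x) = m - 1"
proof -
  have "degree (p m) = 1 + degree (q m x)"
    using q_nonzero[OF assms] by (subst p_eq_q[OF assms], subst degree_mult_eq) auto
  then show ?thesis by (simp add: degree_p)
qed

text \<open>Writing \<open>g\<close> as its value at \<open>x\<close> plus
  \<open>(X - x) * h\<close> turns \<open>g * q m x\<close> into \<open>poly g x\<close> times
  \<open>q m x\<close> plus \<open>h * p m\<close>, and \<open>h\<close> has degree below
  \<open>m\<close>, so \<open>L\<close> kills the last term.\<close>

lemma L_mult_q:
  assumes x: "x \<in> Z m" and "degree g \<le> m"
  shows "L (g * q m x) = poly g x * L (q m x)"
proof -
  have "[:- x, 1:] dvd g - [:poly g x:]"
    by (simp add: poly_eq_0_iff_dvd[symmetric])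
  then obtain h where h: "g - [:poly g x:] = [:- x, 1:] * h" by (rule dvdE)
  have "degree h < m"
  proof (cases "h = 0")
    case False
    then have "degree (g - [:poly g x:]) = 1 + degree h"
      unfolding h by (subst degree_mult_eq) auto
    moreover have "degree (g - [:poly g x:]) \<le> m"
      using assms by (intro degree_diff_le) auto
    ultimately show ?thesis by simp
  qed (use Z_pos[OF x] in simp)
  have "g = [:- x, 1:] * h + [:poly g x:]" using h by (metis diff_add_cancel)
  then have "g * q m x = ([:- x, 1:] * h + [:poly g x:]) * q m x" by (rule arg_cong)
  also have "\<dots> = h * ([:- x, 1:] * q m x) + smult (poly g x) (q m x)"
    by (simp add: algebra_simps)
  also have "\<dots> = h * p m + smult (poly g x) (q m x)"
    by (simp only: p_eq_q[OF x, symmetric])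
  finally have "g * q m x = h * p m + smult (poly g x) (q m x)" .
  with L_mult_p_eq_0[OF \<open>degree h < m\<close>] show ?thesis by (simp add: L_add L_smult)
qed

text \<open>Taking \<open>g = q m x\<close> in \<open>L_mult_q\<close> makes
  \<open>L (q m x * q m x) > 0\<close> a multiple of \<open>poly (q m x) x\<close>.\<close>

lemma poly_q_nonzero:
  assumes "x \<in> Z m"
  shows "poly (q m x) x \<noteq> 0"
  using L_square_pos[OF q_nonzero[OF assms]] L_mult_q[OF assms, of "q m x"] degree_q[OF assms]
  by auto

text \<open>\<open>L (kernel m x * q m x)\<close> is computed twice: by the reproducing property and
  by \<open>L_mult_q\<close>.\<close>

lemma L_q:
  assumes "x \<in> Z m"
  shows "L (q m x) = lam m x * poly (q m x) x"
proof -
  note m = Z_pos[OF assms]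
  have "poly (q m x) x = L (kernel m x * q m x)"
    using m degree_q[OF assms] by (simp add: kernel_reproducing)
  also have "\<dots> = poly (kernel m x) x * L (q m x)"
    using degree_kernel_less[OF m, of x] by (intro L_mult_q[OF assms]) simp
  finally show ?thesis
    using poly_kernel_diag_pos[OF m, of x] by (simp add: lam_def poly_kernel_diag[symmetric])
qed

lemma poly_q_other:
  assumes "x \<in> Z m" "y \<in> Z m" "x \<noteq> y"
  shows "poly (q m x) y = 0"
  using poly_p_eq_q[OF assms(1), of y] assms by (simp add: Z_def)

section \<open>Gauss quadrature\<close>

text \<open>\<open>f\<close> equals its Lagrange interpolant at the zeros, whose basis polynomials
  are multiples of the \<open>q m x\<close>; \<open>L_q\<close> supplies the weights.\<close>

lemma quadrature_low:
  assumes "degree f < m"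
  shows "L f = (\<Sum>x\<in>Z m. lam m x * poly f x)"
proof -
  define g where "g = (\<Sum>x\<in>Z m. smult (poly f x / poly (q m x) x) (q m x))"
  have "f = g"
  proof (rule poly_eqI_degree[of "Z m"])
    fix y assume y: "y \<in> Z m"
    have "poly g y = (\<Sum>x\<in>Z m. if x = y then poly f y else 0)"
      unfolding g_def poly_sum
      using y poly_q_nonzero[OF y] by (intro sum.cong) (auto simp: poly_q_other)
    then show "poly f y = poly g y" using y by simp
  next
    show "degree f < card (Z m)" using assms by (simp add: card_Z)
    have "degree g < m" unfolding g_def using assms
      by (intro degree_sum_less) (auto simp: degree_q)
    then show "degree g < card (Z m)" by (simp add: card_Z)
  qed
  have "L g = (\<Sum>x\<in>Z m. lam m x * poly f x)"
    unfolding g_def L_sum by (intro sum.cong) (auto simp: L_smult L_q poly_q_nonzero)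
  with \<open>f = g\<close> show ?thesis by metis
qed

text \<open>Division by \<open>p m\<close> changes neither side: the quotient has degree below
  \<open>m\<close>, hence is orthogonal to \<open>p m\<close>, and \<open>p m\<close> vanishes at
  the nodes.\<close>

theorem gauss_quadrature:
  assumes "degree f < 2 * m"
  shows "L f = (\<Sum>x\<in>Z m. lam m x * poly f x)"
proof -
  have "m > 0" using assms by simp
  define s r where "s = f div p m" and "r = f mod p m"
  have f: "f = s * p m + r" by (simp add: s_def r_def)
  have "degree r < m"
    using degree_mod_less[of "p m" f] \<open>m > 0\<close> by (auto simp: r_def degree_p)
  have "degree s < m"
  proof (cases "s = 0")
    case False
    have "s * p m = f - r" using f by simp
    then have "degree (s * p m) < 2 * m"
      using assms \<open>degree r < m\<close> by (metis degree_diff_less less_trans mult_2 trans_less_add1)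
    with False show ?thesis by (simp add: degree_mult_eq degree_p)
  qed (use \<open>m > 0\<close> in simp)
  have "L f = L r"
    using L_mult_p_eq_0[OF \<open>degree s < m\<close>] by (simp add: f L_add)
  also have "\<dots> = (\<Sum>x\<in>Z m. lam m x * poly r x)"
    using \<open>degree r < m\<close> by (rule quadrature_low)
  also have "\<dots> = (\<Sum>x\<in>Z m. lam m x * poly f x)"
    by (intro sum.cong) (auto simp: f Z_def)
  finally show ?thesis .
qed

section \<open>Recurrence coefficient and values at the zeros\<close>

text \<open>The recurrence coefficient \<open>a\<^sub>m\<^sub>+\<^sub>1\<close> of the paper.\<close>

definition \<alpha> :: "nat \<Rightarrow> real" where
  "\<alpha> m = lead_coeff (p m) / lead_coeff (p (Suc m))"

text \<open>\<open>\<alpha> m\<close> is the ratio that cancels the leading terms. This degree bound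
  replaces the full three-term recurrence.\<close>

lemma degree_recurrence_remainder:
  "degree (pCons 0 (p m) - smult (\<alpha> m) (p (Suc m))) < Suc m"
proof (rule degree_lessI)
  show "\<forall>i\<ge>Suc m. coeff (pCons 0 (p m) - smult (\<alpha> m) (p (Suc m))) i = 0"
  proof (intro allI impI)
    fix i assume "i \<ge> Suc m"
    show "coeff (pCons 0 (p m) - smult (\<alpha> m) (p (Suc m))) i = 0"
    proof (cases "i = Suc m")
      case True
      then show ?thesis
        using lead_coeff_p[of "Suc m"] by (simp add: \<alpha>_def degree_p)
    next
      case False
      with \<open>i \<ge> Suc m\<close> obtain k where "i = Suc k" "k > m" by (cases i) auto
      then show ?thesis by (simp add: coeff_eq_0 degree_p)
    qed
  qed
qed simp

lemma L_recurrence_coeff: "L (pCons 0 (p m) * p (Suc m)) = \<alpha> m"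
proof -
  define r where "r = pCons 0 (p m) - smult (\<alpha> m) (p (Suc m))"
  have "pCons 0 (p m) * p (Suc m) = r * p (Suc m) + smult (\<alpha> m) (p (Suc m) * p (Suc m))"
    by (simp add: r_def algebra_simps)
  moreover have "L (r * p (Suc m)) = 0"
    unfolding r_def by (rule L_mult_p_eq_0[OF degree_recurrence_remainder])
  ultimately show ?thesis by (simp add: L_add L_smult ortho)
qed

lemma L_mult_q_lam:
  assumes "y \<in> Z m" "degree g \<le> m"
  shows "L (g * q m y) = lam m y * poly (q m y) y * poly g y"
  using L_mult_q[OF assms] L_q[OF assms(1)] by simp

text \<open>Both sides are values of \<open>L (r * q m y)\<close> with \<open>r = X p\<^sub>m - \<alpha>\<^sub>m p\<^sub>m\<^sub>+\<^sub>1\<close>, whose degree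
  is at most \<open>m\<close>.\<close>

lemma lam_q_p:
  assumes y: "y \<in> Z m"
  shows "\<alpha> m * lam m y * poly (q m y) y * poly (p (Suc m)) y = - 1"
proof -
  note m = Z_pos[OF y]
  define r where "r = pCons 0 (p m) - smult (\<alpha> m) (p (Suc m))"
  have "L (r * q m y) = lam m y * poly (q m y) y * poly r y"
    using degree_recurrence_remainder[of m] by (intro L_mult_q_lam[OF y]) (simp add: r_def)
  moreover have "poly r y = - \<alpha> m * poly (p (Suc m)) y"
    using y by (simp add: r_def Z_def)
  \<comment> \<open>Splitting \<open>X = (X - y) + y\<close> gives
    \<open>X * p m * q m y = p m * p m + y * q m y * p m\<close>; terms with \<open>q m y\<close>
    are orthogonal to \<open>p m\<close> and \<open>p (Suc m)\<close>.\<close>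
  moreover have "L (r * q m y) = 1"
  proof -
    have "pCons 0 (p m) * q m y = ([:- y, 1:] * q m y) * p m + smult y (q m y * p m)"
      by (simp add: algebra_simps)
    then have "pCons 0 (p m) * q m y = p m * p m + smult y (q m y * p m)"
      by (simp only: p_eq_q[OF y, symmetric])
    moreover have "r * q m y = pCons 0 (p m) * q m y - smult (\<alpha> m) (q m y * p (Suc m))"
      by (simp only: r_def left_diff_distrib mult_smult_left mult.commute[of "q m y" "p (Suc m)"])
    ultimately have "r * q m y =
        p m * p m + smult y (q m y * p m) - smult (\<alpha> m) (q m y * p (Suc m))"
      by (simp only:)
    moreover have "L (q m y * p m) = 0" "L (q m y * p (Suc m)) = 0"
      using m degree_q[OF y] by (simp_all add: L_mult_p_eq_0)
    ultimately show ?thesis by (simp add: L_add L_diff L_smult ortho)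
  qed
  ultimately show ?thesis by (simp add: algebra_simps)
qed

section \<open>Row and column sums of the matrix\<close>

text \<open>Rows and columns are indexed by the zeros themselves, with \<open>m\<close> for
  \<open>n - 1\<close>; their order is irrelevant to the sums.\<close>

definition entry :: "nat \<Rightarrow> real \<Rightarrow> real \<Rightarrow> real" where
  "entry m y x = (\<alpha> m)\<^sup>2 * lam (Suc m) x * (poly (p m) x)\<^sup>2 * lam m y * (poly (p (Suc m)) y)\<^sup>2
     / (x - y)\<^sup>2"

lemma entry_nonneg: "entry m y x \<ge> 0"
  by (simp add: entry_def lam_nonneg)

lemma entry_eq_q:
  assumes "y \<in> Z m" "x \<in> Z (Suc m)"
  shows "entry m y x =
    (\<alpha> m)\<^sup>2 * lam m y * (poly (p (Suc m)) y)\<^sup>2 * (lam (Suc m) x * (poly (q m y) x)\<^sup>2)"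
proof -
  \<comment> \<open>A common zero would make the product in \<open>lam_q_p\<close> zero instead of
    \<open>- 1\<close>.\<close>
  have "x \<noteq> y" using lam_q_p[OF assms(1)] assms(2) by (auto simp: Z_def)
  then show ?thesis
    by (simp add: entry_def poly_p_eq_q[OF assms(1), of x] power_mult_distrib)
qed

text \<open>This is \<open>lam_q_p\<close> squared. The last factor is
  \<open>L (q m y * q m y)\<close>, so the constant in front of a row is its reciprocal.\<close>

lemma entry_normalisation:
  assumes "y \<in> Z m"
  shows "(\<alpha> m)\<^sup>2 * lam m y * (poly (p (Suc m)) y)\<^sup>2 * (lam m y * (poly (q m y) y)\<^sup>2) = 1"
proof -
  have "(\<alpha> m)\<^sup>2 * lam m y * (poly (p (Suc m)) y)\<^sup>2 * (lam m y * (poly (q m y) y)\<^sup>2) =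
      (\<alpha> m * lam m y * poly (q m y) y * poly (p (Suc m)) y)\<^sup>2"
    by (simp add: power2_eq_square)
  then show ?thesis by (simp add: lam_q_p[OF assms])
qed

lemma entry_row_sum:
  assumes y: "y \<in> Z m"
  shows "(\<Sum>x\<in>Z (Suc m). entry m y x) = 1"
proof -
  have "degree (q m y * q m y) < 2 * Suc m"
    using degree_mult_le[of "q m y" "q m y"] by (simp add: degree_q[OF y])
  from gauss_quadrature[OF this]
  have "(\<Sum>x\<in>Z (Suc m). lam (Suc m) x * (poly (q m y) x)\<^sup>2) = L (q m y * q m y)"
    by (simp add: power2_eq_square)
  also have "\<dots> = lam m y * (poly (q m y) y)\<^sup>2"
    by (simp add: L_mult_q_lam y degree_q power2_eq_square)
  finally show ?thesis
    using y by (simp add: entry_eq_q entry_normalisation sum_distrib_left[symmetric])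
qed

text \<open>\<open>X * q m y\<close> has degree \<open>m\<close>, just within the bound of
  \<open>L_mult_q_lam\<close>, so the extra factor \<open>X\<close> contributes its value
  \<open>y\<close>.\<close>

lemma entry_row_mean:
  assumes y: "y \<in> Z m"
  shows "(\<Sum>x\<in>Z (Suc m). entry m y x * x) = y"
proof -
  define g where "g = pCons 0 (q m y)"
  have poly_g: "poly g t = t * poly (q m y) t" for t by (simp add: g_def)
  have g: "degree g \<le> m"
    using Z_pos[OF y] degree_pCons_le[of 0 "q m y"] by (simp add: g_def degree_q[OF y])
  have "degree (g * q m y) < 2 * Suc m"
    using degree_mult_le[of g "q m y"] g by (simp add: degree_q[OF y])
  from gauss_quadrature[OF this]
  have "(\<Sum>x\<in>Z (Suc m). lam (Suc m) x * (poly (q m y) x)\<^sup>2 * x) = L (g * q m y)"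
    by (simp add: poly_g power2_eq_square ac_simps)
  also have "\<dots> = lam m y * (poly (q m y) y)\<^sup>2 * y"
    by (simp add: L_mult_q_lam y g poly_g power2_eq_square)
  finally have "(\<alpha> m)\<^sup>2 * lam m y * (poly (p (Suc m)) y)\<^sup>2 *
      (\<Sum>x\<in>Z (Suc m). lam (Suc m) x * (poly (q m y) x)\<^sup>2 * x) = y"
    using entry_normalisation[OF y] by (simp add: mult.assoc[symmetric])
  then show ?thesis
    using y by (simp add: entry_eq_q sum_distrib_left mult.assoc)
qed

lemma last_row_sum: "(\<Sum>x\<in>Z (Suc m). lam (Suc m) x * (poly (p m) x)\<^sup>2) = 1"
  using gauss_quadrature[of "p m * p m" "Suc m"]
  by (simp add: degree_mult_eq degree_p ortho power2_eq_square)

text \<open>The integrand has degree \<open>2 * m + 1\<close>, the largest for which quadrature at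
  \<open>m + 1\<close> nodes is exact.\<close>

lemma last_row_mean:
  "(\<Sum>x\<in>Z (Suc m). lam (Suc m) x * (poly (p m) x)\<^sup>2 * x) = L (pCons 0 (p m * p m))"
  using gauss_quadrature[of "pCons 0 (p m * p m)" "Suc m"]
  by (simp add: degree_mult_eq degree_p power2_eq_square ac_simps)

text \<open>The column sums evaluate \<open>L (k * k) = k(x)\<close>, for \<open>k\<close> the reproducing kernel at \<open>x\<close>, by
  quadrature at the zeros of \<open>p m\<close>.\<close>

lemma entry_column_sum:
  assumes x: "x \<in> Z (Suc m)"
  shows "(\<Sum>y\<in>Z m. entry m y x) + lam (Suc m) x * (poly (p m) x)\<^sup>2 = 1"
proof -
  define k where "k = kernel m x"
  have "(\<Sum>y\<in>Z m. entry m y x) = lam (Suc m) x * poly k x"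
  proof (cases "m = 0")
    \<comment> \<open>Here both sides are empty sums; the bound \<open>degree k < m\<close> needed
      below fails.\<close>
    case True
    then have "Z m = {}" using Z_pos by blast
    with True show ?thesis by (simp add: k_def kernel_def)
  next
    case False
    then have k: "degree k < m" by (simp add: k_def degree_kernel_less)
    have "entry m y x = lam (Suc m) x * (lam m y * (poly k y)\<^sup>2)" if y: "y \<in> Z m" for y
    proof -
      have "poly (q m y) x = L (k * q m y)"
        using False by (simp add: k_def kernel_reproducing degree_q[OF y])
      also have "\<dots> = lam m y * poly (q m y) y * poly k y"
        using k by (simp add: L_mult_q_lam[OF y])
      finally have qx: "poly (q m y) x = lam m y * poly (q m y) y * poly k y" .
      \<comment> \<open>Squaring \<open>qx\<close> produces the factor
        \<open>lam m y * (poly (q m y) y)\<^sup>2\<close>, which the normalisation cancels against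
        the row constant.\<close>
      show ?thesis
        using arg_cong[OF entry_normalisation[OF y],
            of "\<lambda>t. t * (lam (Suc m) x * (lam m y * (poly k y)\<^sup>2))"]
        by (simp add: entry_eq_q[OF y x] qx power2_eq_square ac_simps)
    qed
    then have "(\<Sum>y\<in>Z m. entry m y x) = lam (Suc m) x * (\<Sum>y\<in>Z m. lam m y * (poly k y)\<^sup>2)"
      by (simp add: sum_distrib_left)
    also have "(\<Sum>y\<in>Z m. lam m y * (poly k y)\<^sup>2) = L (k * k)"
      using degree_mult_le[of k k] k by (simp add: gauss_quadrature[of _ m] power2_eq_square)
    also have "\<dots> = poly k x"
      using kernel_reproducing[OF k, of x] by (simp add: k_def)
    finally show ?thesis .
  qed
  \<comment> \<open>The bracket is the diagonal value of \<open>kernel (Suc m) x\<close>, whose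
    reciprocal is \<open>lam (Suc m) x\<close>.\<close>
  moreover have "lam (Suc m) x * (poly k x + (poly (p m) x)\<^sup>2) = 1"
    using poly_kernel_diag_pos[of "Suc m" x]
    by (simp add: lam_def k_def poly_kernel_diag)
  ultimately show ?thesis by (simp add: distrib_left)
qed

section \<open>From sets of zeros to their increasing enumeration\<close>

text \<open>By \<open>card_Z\<close> the sorted list has exactly \<open>m\<close> entries, so every
  index below \<open>m\<close> is valid and every zero is reached.\<close>

lemma bij_betw_poly_zero: "bij_betw (\<lambda>j. poly_zero p (j + 1) m) {..<m} (Z m)"
proof -
  have "bij_betw ((!) (sorted_list_of_set (Z m))) {..<m} (Z m)"
    by (rule bij_betw_nth) (simp_all add: card_Z)
  then show ?thesis by (simp add: poly_zero_def Z_def)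
qed

lemma poly_zero_in_Z: "j < m \<Longrightarrow> poly_zero p (Suc j) m \<in> Z m"
  using bij_betw_apply[OF bij_betw_poly_zero, of j m] by simp

lemma sum_poly_zero: "(\<Sum>j<m. f (poly_zero p (Suc j) m)) = (\<Sum>x\<in>Z m. f x)"
  using sum.reindex_bij_betw[OF bij_betw_poly_zero, of f m] by simp

lemma christoffel_eq: "christoffel p j m = lam m (poly_zero p j m)"
  by (simp add: christoffel_def lam_def)

end

section \<open>The integral as the functional, and the matrix identity\<close>

lemma integrable_poly:
  fixes M :: "real measure"
  assumes "\<And>k. integrable M (\<lambda>x. x ^ k)"
  shows "integrable M (poly f)"
  unfolding poly_altdef[abs_def] by (intro Bochner_Integration.integrable_sum integrable_mult_right assms)

text \<open>Finite moments make every polynomial integrable, which gives additivity of the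
  integral.\<close>

lemma orthonormal_functional_integral:
  fixes M :: "real measure"
  assumes moments: "\<And>k. integrable M (\<lambda>x. x ^ k)" and "orthonormal_polys M p"
  shows "orthonormal_functional (\<lambda>f. \<integral>x. poly f x \<partial>M) p"
proof unfold_locales
  show "lead_coeff (p m) > 0" for m
    using assms(2) unfolding orthonormal_polys_def by blast
qed (use assms(2) integrable_poly[OF moments] in \<open>auto simp: orthonormal_polys_def\<close>)

theorem theorem2p1:
  fixes M :: "real measure" and p :: "nat \<Rightarrow> real poly" and n :: nat
  assumes "real_distribution M"
    and "infinite (measure_support M)"
    and "\<And>k. integrable M (\<lambda>x. x ^ k)"
    and "orthonormal_polys M p"
    and "n \<ge> 1"
  shows "Matrix.vec n (\<lambda>i. if i < n - 1 then poly_zero p (i + 1) (n - 1) else rec_b M p (n - 1))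
           = zeros_mat M p n *\<^sub>v Matrix.vec n (\<lambda>j. poly_zero p (j + 1) n)
         \<and> doubly_stochastic (zeros_mat M p n)"
proof -
  interpret orthonormal_functional "\<lambda>f. \<integral>x. poly f x \<partial>M" p
    using assms(3,4) by (rule orthonormal_functional_integral)
  obtain m where n: "n = Suc m" using \<open>n \<ge> 1\<close> by (cases n) auto
  have rec_a: "rec_a M p n = \<alpha> m"
    using L_recurrence_coeff[of m] by (simp add: rec_a_def n ac_simps)
  have rec_b: "rec_b M p m = (\<Sum>x\<in>Z n. lam n x * (poly (p m) x)\<^sup>2 * x)"
    unfolding n last_row_mean rec_b_def
    by (rule Bochner_Integration.integral_cong) (simp_all add: power2_eq_square)
  have upper: "zeros_mat_entry M p n (Suc i) (Suc j) =
      entry m (poly_zero p (Suc i) m) (poly_zero p (Suc j) n)" if "i < m" for i j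
    using that rec_a by (simp add: zeros_mat_entry_def entry_def christoffel_eq n)
  have lower: "zeros_mat_entry M p n (Suc m) (Suc j) =
      lam n (poly_zero p (Suc j) n) * (poly (p m) (poly_zero p (Suc j) n))\<^sup>2" for j
    by (simp add: zeros_mat_entry_def christoffel_eq n)
  have row: "(\<Sum>j<n. zeros_mat_entry M p n (Suc i) (Suc j)) = 1" if "i < n" for i
  proof (cases "i < m")
    case True
    then show ?thesis
      using sum_poly_zero[of "entry m (poly_zero p (Suc i) m)" n]
        entry_row_sum[OF poly_zero_in_Z[OF True]]
      by (simp add: upper n[symmetric])
  next
    case False
    with that have "i = m" by (simp add: n)
    then show ?thesis
      using sum_poly_zero[of "\<lambda>x. lam n x * (poly (p m) x)\<^sup>2" n] last_row_sum[of m]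
      by (simp add: lower[folded n] n[symmetric])
  qed
  have mean: "(\<Sum>j<n. zeros_mat_entry M p n (Suc i) (Suc j) * poly_zero p (Suc j) n) =
      (if i < m then poly_zero p (Suc i) m else rec_b M p m)" if "i < n" for i
  proof (cases "i < m")
    case True
    then show ?thesis
      using sum_poly_zero[of "\<lambda>x. entry m (poly_zero p (Suc i) m) x * x" n]
        entry_row_mean[OF poly_zero_in_Z[OF True]]
      by (simp add: upper n[symmetric])
  next
    case False
    with that have "i = m" by (simp add: n)
    then show ?thesis
      using sum_poly_zero[of "\<lambda>x. lam n x * (poly (p m) x)\<^sup>2 * x" n] by (simp add: lower rec_b)
  qed
  have column: "(\<Sum>i<n. zeros_mat_entry M p n (Suc i) (Suc j)) = 1" if "j < n" for j
  proof -
    define x where "x = poly_zero p (Suc j) n"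
    have "x \<in> Z (Suc m)" using poly_zero_in_Z[OF that] by (simp add: x_def n)
    have "(\<Sum>i<n. zeros_mat_entry M p n (Suc i) (Suc j)) =
        (\<Sum>i<m. entry m (poly_zero p (Suc i) m) x) + lam n x * (poly (p m) x)\<^sup>2"
      using sum.lessThan_Suc[of "\<lambda>i. zeros_mat_entry M p n (Suc i) (Suc j)" m]
      by (simp add: n[symmetric] upper lower[folded n] x_def)
    also have "\<dots> = 1"
      using sum_poly_zero[of "\<lambda>y. entry m y x" m] entry_column_sum[OF \<open>x \<in> Z (Suc m)\<close>]
      by (simp add: n[symmetric])
    finally show ?thesis .
  qed
  have nonneg: "zeros_mat_entry M p n (Suc i) (Suc j) \<ge> 0" if "i < n" for i j
  proof (cases "i < m")
    case True
    then show ?thesis by (simp add: upper entry_nonneg)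
  next
    case False
    with that have "i = m" by (simp add: n)
    then show ?thesis by (simp add: lower lam_nonneg)
  qed
  have "n - 1 = m" by (simp add: n)
  then have "Matrix.vec n (\<lambda>i. if i < n - 1 then poly_zero p (i + 1) (n - 1) else rec_b M p (n - 1))
      = zeros_mat M p n *\<^sub>v Matrix.vec n (\<lambda>j. poly_zero p (j + 1) n)"
    by (intro eq_vecI) (auto simp: zeros_mat_def scalar_prod_def atLeast0LessThan mean)
  moreover have "doubly_stochastic (zeros_mat M p n)"
    using row column nonneg by (simp add: doubly_stochastic_def zeros_mat_def)
  ultimately show ?thesis ..
qed

end
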